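(* Let $(X_n)_{n\ge0}$ be a stochastic process taking values in $[0,1]$, adapted to a filtration $(\mathcal{F}_n)$, and satisfying the stochastic approximation algorithm $$X_{n+1}-X_n=\gamma_{n+1}\big[g(X_n)+U_{n+1}\big],\qquad X_0=x_0,$$ where $\gamma_n$ and $U_n$ are $\mathcal{F}_n$-measurable real random variables and $g:[0,1]\to\mathbb{R}$ is a function. Assume that there are positive constants $u_l,u_u,K_g,K_u,K_e$ such that the following hold almost surely: (1) for any $n$, $\frac{u_l}{n}\le\gamma_n\le\frac{u_u}{n}$; (2) for any $x\in[0,1]$, $|g(x)|\le K_g$; (3) for any $n$, $|U_{n+1}|\le K_u$; (4) for any $n$, $\left|\mathbb{E}\left(\gamma_{n+1}U_{n+1}\mid\mathcal{F}_n\right)\right|\le\frac{K_e}{n^2}$. Furthermore, assume that $g$ is non-increasing and continuous on $[0,1]$, and that $x^*$ is the unique stable point of $g$. Then for any $\varepsilon>0$ there exists a constant $a>0$, independent of $n$, such that for all $n$ large enough $$\mathbb{P}\big(|X_{n+1}-x^*|>\varepsilon\big)\le 2e^{-an}.$$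
   Context: A stable point of $g$ is a zero $x^*$ of $g$ (i.e. $g(x^* )=0$) at which $g$ is differentiable with $g'(x^* )<0$. Indices $n$ range over those integers for which the displayed expressions make sense (in particular $n\ge1$ wherever one divides by $n$). *)

theory Defs
  imports "HOL-Probability.Probability"
begin

text \<open>
  Since \<open>g\<close> is a function on \<open>[0,1]\<close>, its values outside \<open>{0..1}\<close> are irrelevant: the zero must
  lie in \<open>{0..1}\<close> and the derivative is taken within \<open>{0..1}\<close>, so it is the ordinary derivative
  at interior points and the one-sided derivative at the endpoints.
\<close>
definition stable_point :: "(real \<Rightarrow> real) \<Rightarrow> real \<Rightarrow> bool" where
  "stable_point g x \<longleftrightarrow>
     x \<in> {0..1} \<and> g x = 0 \<and> (\<exists>D<0. (g has_real_derivative D) (at x within {0..1}))"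

end

theory Submission
  imports Defs "HOL-Real_Asymp.Real_Asymp"
begin

text \<open>
  Fix \<open>\<epsilon>\<close> and let \<open>Y n = X n - xstar - \<epsilon>/2\<close>; the lower deviation is treated in the same way, with
  \<open>Y n = xstar - \<epsilon>/2 - X n\<close>. Because \<open>g\<close> is non-increasing and its derivative at \<open>xstar\<close> is negative,
  \<open>g\<close> is bounded away from zero outside every neighbourhood of \<open>xstar\<close>
  (\<open>antimono_strict_beyond_stable_point\<close>). So while \<open>Y\<close> is positive, its step at time \<open>n\<close> is at most
  \<open>- d / n\<close> plus a noise term of size \<open>O(1/n)\<close> whose conditional mean is only \<open>O(1/n\<^sup>2)\<close>.

  The tail bound is a Chernoff bound for \<open>exp (\<theta> * Y n)\<close>. Up to second order, noise of size \<open>C / k\<close>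
  costs a factor \<open>exp (\<theta>\<^sup>2 * C\<^sup>2 / k\<^sup>2)\<close>, against a gain of \<open>exp (- \<theta> * d / k)\<close> from the
  drift. The drift wins as long as \<open>\<theta>\<close> is at most a small multiple of \<open>k\<close>. If \<open>Y k\<close> is not
  positive, the next value of the exponential is at most \<open>exp 1\<close>, since one step moves \<open>Y\<close> by only \<open>O(1/k)\<close>. Hence
  \<open>E (exp (\<theta> * Y (k+1))) \<le> exp (- \<theta> * d / (2 * k)) * E (exp (\<theta> * Y k)) + 3\<close>
  (\<open>exp_moment_step\<close>).

  To reach time \<open>n\<close>, this is iterated only from \<open>m \<approx> \<beta> * n\<close> on, with one fixed \<open>\<theta>\<close>
  proportional to \<open>m\<close>, hence to \<open>n\<close>. As \<open>Y\<close> is bounded by \<open>B\<close>, the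
  initial moment is at most \<open>exp (\<theta> * B)\<close>, and the accumulated contraction is
  \<open>exp (- (\<theta> * d / 2) * ln (n / m))\<close>. A small constant \<open>\<beta>\<close> makes the second factor
  cancel the first, however large \<open>\<theta>\<close> is. The moment at time \<open>n\<close> is then at most \<open>1 + 3 * n\<close>, and
  Markov's inequality gives \<open>P (Y n > \<epsilon>/2) \<le> (1 + 3 * n) * exp (- \<theta> * \<epsilon>/2)\<close>, which is
  exponentially small in \<open>n\<close> (\<open>exponential_tail_of_harmonic_drift\<close>).
\<close>

section \<open>Elementary inequalities\<close>

lemma exp_le_quadratic:
  fixes x :: real
  assumes "\<bar>x\<bar> \<le> 1"
  shows "exp x \<le> 1 + x + x\<^sup>2"
proof (cases "x \<ge> 0")
  case True
  then show ?thesis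
    using assms by (intro exp_bound) auto
next
  case False
  have cube: "0 \<le> - (x ^ 3)"
    using False by (simp add: power3_eq_cube mult_nonpos_nonpos mult_nonneg_nonpos)
  have "exp x * (1 - x) \<le> exp x * exp (- x)"
    using exp_ge_add_one_self[of "- x"] by (intro mult_left_mono) auto
  also have "\<dots> = 1"
    by (simp flip: exp_add)
  also have "1 \<le> (1 + x + x\<^sup>2) * (1 - x)"
    using cube by (simp add: algebra_simps power2_eq_square power3_eq_cube)
  finally show ?thesis
    using False by (simp add: mult_le_cancel_right)
qed

lemma ln_Suc_diff_le:
  assumes "n \<ge> 1"
  shows "ln (real (Suc n)) - ln (real n) \<le> 1 / real n"
proof -
  have "ln (real (Suc n)) - ln (real n) = ln (real (Suc n) / real n)"
    using assms by (subst ln_div) auto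
  also have "real (Suc n) / real n = 1 + 1 / real n"
    using assms by (simp add: field_simps)
  also have "ln \<dots> \<le> 1 / real n"
    by (rule ln_add_one_self_le_self) simp
  finally show ?thesis .
qed

section \<open>Exponential moments under one step of noise\<close>

text \<open>
  To second order, \<open>exp (\<theta> * \<xi>) \<le> 1 + \<theta> * \<xi> + (\<theta> * b)\<^sup>2\<close>. The weight \<open>h\<close> is measurable with
  respect to \<open>F\<close>, so in the linear term the noise may be replaced by its conditional mean; the
  bound for the sum is \<open>1 + x \<le> exp x\<close>.
\<close>
lemma (in finite_measure_subalgebra) integral_mult_exp_noise_le:
  fixes h \<xi> :: "'a \<Rightarrow> real"
  assumes h_meas: "h \<in> borel_measurable F"
    and h_bound: "AE \<omega> in M. 0 \<le> h \<omega> \<and> h \<omega> \<le> H"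
    and \<xi>_meas: "\<xi> \<in> borel_measurable M"
    and \<xi>_bound: "AE \<omega> in M. \<bar>\<xi> \<omega>\<bar> \<le> b"
    and \<xi>_mean: "AE \<omega> in M. real_cond_exp M F \<xi> \<omega> \<le> k"
    and \<theta>: "0 \<le> \<theta>" "\<theta> * b \<le> 1"
  shows "(\<integral>\<omega>. h \<omega> * exp (\<theta> * \<xi> \<omega>) \<partial>M) \<le> exp (\<theta> * k + (\<theta> * b)\<^sup>2) * (\<integral>\<omega>. h \<omega> \<partial>M)"
    and "integrable M (\<lambda>\<omega>. h \<omega> * exp (\<theta> * \<xi> \<omega>))"
proof -
  note [measurable] = \<xi>_meas measurable_from_subalg[OF subalg h_meas]
  have int_h: "integrable M h"
    by (rule integrable_const_bound[where B = H]) (use h_bound in auto)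
  have int_h\<xi>: "integrable M (\<lambda>\<omega>. h \<omega> * \<xi> \<omega>)"
  proof (rule integrable_const_bound[where B = "H * b"])
    show "AE \<omega> in M. norm (h \<omega> * \<xi> \<omega>) \<le> H * b"
      using h_bound \<xi>_bound by eventually_elim (auto simp: abs_mult intro!: mult_mono)
  qed simp
  show int_hexp: "integrable M (\<lambda>\<omega>. h \<omega> * exp (\<theta> * \<xi> \<omega>))"
  proof (rule integrable_const_bound[where B = "H * exp 1"])
    show "AE \<omega> in M. norm (h \<omega> * exp (\<theta> * \<xi> \<omega>)) \<le> H * exp 1"
      using h_bound \<xi>_bound
    proof eventually_elim
      case (elim \<omega>)
      have "\<theta> * \<xi> \<omega> \<le> \<theta> * b"
        using elim \<theta> by (intro mult_left_mono) auto
      then show ?case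
        using elim \<theta> by (auto simp: abs_mult intro!: mult_mono)
    qed
  qed simp
  have "(\<integral>\<omega>. h \<omega> * exp (\<theta> * \<xi> \<omega>) \<partial>M)
      \<le> (\<integral>\<omega>. (1 + (\<theta> * b)\<^sup>2) * h \<omega> + \<theta> * (h \<omega> * \<xi> \<omega>) \<partial>M)"
  proof (rule integral_mono_AE)
    show "AE \<omega> in M. h \<omega> * exp (\<theta> * \<xi> \<omega>) \<le> (1 + (\<theta> * b)\<^sup>2) * h \<omega> + \<theta> * (h \<omega> * \<xi> \<omega>)"
      using h_bound \<xi>_bound
    proof eventually_elim
      case (elim \<omega>)
      have small: "\<bar>\<theta> * \<xi> \<omega>\<bar> \<le> \<theta> * b"
        using elim \<theta> by (auto simp: abs_mult intro!: mult_left_mono)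
      have "exp (\<theta> * \<xi> \<omega>) \<le> 1 + \<theta> * \<xi> \<omega> + (\<theta> * \<xi> \<omega>)\<^sup>2"
        using small \<theta> by (intro exp_le_quadratic) linarith
      also have "(\<theta> * \<xi> \<omega>)\<^sup>2 \<le> (\<theta> * b)\<^sup>2"
        using small by (rule abs_le_square_iff[THEN iffD1, OF order_trans]) simp
      finally have "h \<omega> * exp (\<theta> * \<xi> \<omega>) \<le> h \<omega> * (1 + \<theta> * \<xi> \<omega> + (\<theta> * b)\<^sup>2)"
        using elim by (intro mult_left_mono) auto
      then show ?case
        by (simp add: algebra_simps)
    qed
  qed (use int_h int_h\<xi> int_hexp in auto)
  also have "\<dots> = (1 + (\<theta> * b)\<^sup>2) * (\<integral>\<omega>. h \<omega> \<partial>M) + \<theta> * (\<integral>\<omega>. h \<omega> * \<xi> \<omega> \<partial>M)"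
    using int_h int_h\<xi> by simp
  also have "(\<integral>\<omega>. h \<omega> * \<xi> \<omega> \<partial>M) = (\<integral>\<omega>. h \<omega> * real_cond_exp M F \<xi> \<omega> \<partial>M)"
    using real_cond_exp_intg(2)[OF int_h\<xi> h_meas \<xi>_meas] by simp
  also have "\<dots> \<le> (\<integral>\<omega>. h \<omega> * k \<partial>M)"
  proof (rule integral_mono_AE)
    show "AE \<omega> in M. h \<omega> * real_cond_exp M F \<xi> \<omega> \<le> h \<omega> * k"
      using h_bound \<xi>_mean by eventually_elim (auto intro!: mult_left_mono)
  qed (use real_cond_exp_intg(1)[OF int_h\<xi> h_meas \<xi>_meas] int_h in auto)
  also have "(1 + (\<theta> * b)\<^sup>2) * (\<integral>\<omega>. h \<omega> \<partial>M) + \<theta> * (\<integral>\<omega>. h \<omega> * k \<partial>M)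
      = (1 + (\<theta> * k + (\<theta> * b)\<^sup>2)) * (\<integral>\<omega>. h \<omega> \<partial>M)"
    by (simp add: algebra_simps)
  also have "\<dots> \<le> exp (\<theta> * k + (\<theta> * b)\<^sup>2) * (\<integral>\<omega>. h \<omega> \<partial>M)"
  proof (rule mult_right_mono)
    show "0 \<le> (\<integral>\<omega>. h \<omega> \<partial>M)"
      by (rule integral_nonneg_AE) (use h_bound in auto)
  qed (rule exp_ge_add_one_self)
  finally show "(\<integral>\<omega>. h \<omega> * exp (\<theta> * \<xi> \<omega>) \<partial>M)
      \<le> exp (\<theta> * k + (\<theta> * b)\<^sup>2) * (\<integral>\<omega>. h \<omega> \<partial>M)"
    using \<theta> by (simp add: mult_left_mono)
qed

text \<open>
  Where \<open>Y\<close> is positive, the drift \<open>- \<delta>\<close> is available, and by the hypothesis \<open>small\<close> the noise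
  consumes at most half of it. Elsewhere \<open>\<theta> * Y'\<close> is at most \<open>\<theta> * c \<le> 1\<close>, which accounts for the additive
  constant \<open>3 \<ge> exp 1\<close>. The weight \<open>h\<close> separates the two regions.
\<close>
lemma (in finite_measure_subalgebra) exp_moment_step:
  fixes Y Y' \<xi> :: "'a \<Rightarrow> real"
  assumes Y_meas: "Y \<in> borel_measurable F"
    and Y'_meas: "Y' \<in> borel_measurable M"
    and Y_bound: "AE \<omega> in M. Y \<omega> \<le> B"
    and increment: "AE \<omega> in M. \<bar>Y' \<omega> - Y \<omega>\<bar> \<le> c"
    and drift: "AE \<omega> in M. Y \<omega> > 0 \<longrightarrow> Y' \<omega> \<le> Y \<omega> - \<delta> + \<xi> \<omega>"
    and \<xi>_meas: "\<xi> \<in> borel_measurable M"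
    and \<xi>_bound: "AE \<omega> in M. \<bar>\<xi> \<omega>\<bar> \<le> c"
    and \<xi>_mean: "AE \<omega> in M. real_cond_exp M F \<xi> \<omega> \<le> k"
    and \<theta>: "0 \<le> \<theta>" "\<theta> * c \<le> 1"
    and small: "k + \<theta> * c\<^sup>2 \<le> \<delta> / 2"
  shows "(\<integral>\<omega>. exp (\<theta> * Y' \<omega>) \<partial>M)
    \<le> exp (- \<theta> * \<delta> / 2) * (\<integral>\<omega>. exp (\<theta> * Y \<omega>) \<partial>M) + 3 * measure M (space M)"
proof -
  note [measurable] = Y'_meas \<xi>_meas measurable_from_subalg[OF subalg Y_meas]
  define h where "h \<omega> = (if Y \<omega> > 0 then exp (\<theta> * Y \<omega>) else 0)" for \<omega>
  have h_meas: "h \<in> borel_measurable F"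
    unfolding h_def using Y_meas by measurable
  note [measurable] = measurable_from_subalg[OF subalg h_meas]
  have h_bound: "AE \<omega> in M. 0 \<le> h \<omega> \<and> h \<omega> \<le> exp (\<theta> * B)"
    using Y_bound \<theta> by (auto simp: h_def intro!: mult_left_mono)
  note noise = integral_mult_exp_noise_le[OF h_meas h_bound \<xi>_meas \<xi>_bound \<xi>_mean \<theta>]
  have int_h: "integrable M h"
    by (rule integrable_const_bound[where B = "exp (\<theta> * B)"]) (use h_bound in auto)
  have int_Y: "integrable M (\<lambda>\<omega>. exp (\<theta> * Y \<omega>))"
    by (rule integrable_const_bound[where B = "exp (\<theta> * B)"])
      (use Y_bound \<theta> in \<open>auto intro!: mult_left_mono\<close>)
  have int_Y': "integrable M (\<lambda>\<omega>. exp (\<theta> * Y' \<omega>))"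
  proof (rule integrable_const_bound[where B = "exp (\<theta> * (B + c))"])
    show "AE \<omega> in M. norm (exp (\<theta> * Y' \<omega>)) \<le> exp (\<theta> * (B + c))"
      using Y_bound increment by eventually_elim (use \<theta> in \<open>auto intro!: mult_left_mono\<close>)
  qed simp
  have "(\<integral>\<omega>. exp (\<theta> * Y' \<omega>) \<partial>M)
      \<le> (\<integral>\<omega>. exp (- \<theta> * \<delta>) * (h \<omega> * exp (\<theta> * \<xi> \<omega>)) + 3 \<partial>M)"
  proof (rule integral_mono_AE)
    show "AE \<omega> in M. exp (\<theta> * Y' \<omega>) \<le> exp (- \<theta> * \<delta>) * (h \<omega> * exp (\<theta> * \<xi> \<omega>)) + 3"
      using increment drift
    proof eventually_elim
      case (elim \<omega>)
      show ?case
      proof (cases "Y \<omega> > 0")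
        case True
        then have "\<theta> * Y' \<omega> \<le> \<theta> * (Y \<omega> - \<delta> + \<xi> \<omega>)"
          using elim \<theta> by (intro mult_left_mono) auto
        then have "exp (\<theta> * Y' \<omega>) \<le> exp (- \<theta> * \<delta>) * (exp (\<theta> * Y \<omega>) * exp (\<theta> * \<xi> \<omega>))"
          by (simp add: algebra_simps flip: exp_add)
        then show ?thesis
          using True by (simp add: h_def)
      next
        case False
        then have "\<theta> * Y' \<omega> \<le> \<theta> * c"
          using elim \<theta> by (intro mult_left_mono) auto
        then have "exp (\<theta> * Y' \<omega>) \<le> exp 1"
          using \<theta> by simp
        also have "\<dots> \<le> 3"
          by (rule exp_le)
        finally show ?thesis
          using False by (simp add: h_def)
      qed
    qed
  qed (use int_Y' noise(2) in auto)
  also have "\<dots> = exp (- \<theta> * \<delta>) * (\<integral>\<omega>. h \<omega> * exp (\<theta> * \<xi> \<omega>) \<partial>M) + 3 * measure M (space M)"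
    using noise(2) by simp
  also have "(\<integral>\<omega>. h \<omega> * exp (\<theta> * \<xi> \<omega>) \<partial>M)
      \<le> exp (\<theta> * k + (\<theta> * c)\<^sup>2) * (\<integral>\<omega>. exp (\<theta> * Y \<omega>) \<partial>M)"
  proof (rule order_trans[OF noise(1)], rule mult_left_mono)
    show "(\<integral>\<omega>. h \<omega> \<partial>M) \<le> (\<integral>\<omega>. exp (\<theta> * Y \<omega>) \<partial>M)"
      by (rule integral_mono[OF int_h int_Y]) (simp add: h_def)
  qed simp
  also have "exp (- \<theta> * \<delta>) * (exp (\<theta> * k + (\<theta> * c)\<^sup>2) * (\<integral>\<omega>. exp (\<theta> * Y \<omega>) \<partial>M))
      = exp (\<theta> * (k + \<theta> * c\<^sup>2) - \<theta> * \<delta>) * (\<integral>\<omega>. exp (\<theta> * Y \<omega>) \<partial>M)"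
    by (simp add: algebra_simps power2_eq_square flip: exp_add)
  also have "\<dots> \<le> exp (- \<theta> * \<delta> / 2) * (\<integral>\<omega>. exp (\<theta> * Y \<omega>) \<partial>M)"
  proof (rule mult_right_mono)
    have "\<theta> * (k + \<theta> * c\<^sup>2) \<le> \<theta> * (\<delta> / 2)"
      using small \<theta> by (intro mult_left_mono) auto
    then show "exp (\<theta> * (k + \<theta> * c\<^sup>2) - \<theta> * \<delta>) \<le> exp (- \<theta> * \<delta> / 2)"
      by (simp add: field_simps)
  qed simp
  finally show ?thesis
    by simp
qed

section \<open>Iteration over harmonic steps\<close>

text \<open>
  The contraction exponents \<open>r / k\<close> add up to at least \<open>r * ln (n / m)\<close>. The additive terms are never
  amplified, so they contribute at most \<open>D\<close> each.
\<close>
lemma harmonic_contraction_iterate: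
  fixes w :: "nat \<Rightarrow> real"
  assumes "1 \<le> m" "m \<le> n" "0 \<le> r" "0 \<le> D"
    and w_nonneg: "\<And>k. 0 \<le> w k"
    and step: "\<And>k. m \<le> k \<Longrightarrow> w (Suc k) \<le> exp (- r / real k) * w k + D"
  shows "w n \<le> exp (- r * (ln (real n) - ln (real m))) * w m + D * real n"
  using \<open>m \<le> n\<close>
proof (induction n rule: dec_induct)
  case base
  then show ?case
    using \<open>0 \<le> D\<close> by simp
next
  case (step n)
  have n: "1 \<le> n"
    using step \<open>1 \<le> m\<close> by simp
  have "w (Suc n) \<le> exp (- r / real n) * w n + D"
    using step assms(6) by simp
  also have "\<dots> \<le> exp (- r / real n) * (exp (- r * (ln (real n) - ln (real m))) * w m + D * real n) + D"
    using step.IH by (simp add: mult_left_mono)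
  also have "\<dots> = exp (- r / real n - r * (ln (real n) - ln (real m))) * w m
      + exp (- r / real n) * (D * real n) + D"
    by (simp add: algebra_simps flip: exp_add)
  also have "\<dots> \<le> exp (- r * (ln (real (Suc n)) - ln (real m))) * w m + 1 * (D * real n) + D"
  proof -
    have "r * (ln (real (Suc n)) - ln (real n)) \<le> r * (1 / real n)"
      using ln_Suc_diff_le[OF n] \<open>0 \<le> r\<close> by (rule mult_left_mono)
    then have "- r / real n - r * (ln (real n) - ln (real m)) \<le> - r * (ln (real (Suc n)) - ln (real m))"
      by (simp add: algebra_simps)
    moreover have "exp (- r / real n) \<le> 1"
      using \<open>0 \<le> r\<close> by simp
    ultimately show ?thesis
      using w_nonneg[of m] \<open>0 \<le> D\<close>
      by (intro add_mono mult_right_mono order_refl) auto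
  qed
  finally show ?case
    by (simp add: algebra_simps)
qed

lemma eventually_linear_times_exp_le:
  fixes A c :: real
  assumes "c > 0"
  shows "\<forall>\<^sub>F n in sequentially. (1 + 3 * real n) * (A * exp (- c * real n)) \<le> exp (- (c / 2) * real n)"
proof -
  have "(\<lambda>n. (1 + 3 * real n) * (A * exp (- (c / 2) * real n))) \<longlonglongrightarrow> 0"
    using assms by real_asymp
  then have "\<forall>\<^sub>F n in sequentially. (1 + 3 * real n) * (A * exp (- (c / 2) * real n)) < 1"
    by (rule order_tendstoD) simp
  then show ?thesis
  proof eventually_elim
    case (elim n)
    have "(1 + 3 * real n) * (A * exp (- c * real n))
        = (1 + 3 * real n) * (A * exp (- (c / 2) * real n)) * exp (- (c / 2) * real n)"
      by (simp add: mult.assoc flip: exp_add)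
    also have "\<dots> \<le> 1 * exp (- (c / 2) * real n)"
      using elim by (intro mult_right_mono) auto
    finally show ?case
      by simp
  qed
qed

text \<open>
  The comparison of \<open>Y\<close> with its drift is pathwise and concerns the step as a whole: only the noise enters through a
  conditional expectation.
\<close>
lemma exponential_tail_of_harmonic_drift:
  fixes Y \<xi> :: "nat \<Rightarrow> 'a \<Rightarrow> real"
  assumes "prob_space M"
    and subalg: "\<And>n. subalgebra M (F n)"
    and Y_meas: "\<And>n. Y n \<in> borel_measurable (F n)"
    and Y_bound: "\<And>n. AE \<omega> in M. Y n \<omega> \<le> B"
    and \<xi>_meas: "\<And>n. \<xi> n \<in> borel_measurable M"
    and increment: "\<And>n. 1 \<le> n \<Longrightarrow> AE \<omega> in M. \<bar>Y (Suc n) \<omega> - Y n \<omega>\<bar> \<le> C / real n"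
    and \<xi>_bound: "\<And>n. 1 \<le> n \<Longrightarrow> AE \<omega> in M. \<bar>\<xi> n \<omega>\<bar> \<le> C / real n"
    and drift: "\<And>n. 1 \<le> n \<Longrightarrow>
      AE \<omega> in M. Y n \<omega> > 0 \<longrightarrow> Y (Suc n) \<omega> \<le> Y n \<omega> - d / real n + \<xi> n \<omega>"
    and \<xi>_mean: "\<And>n. 1 \<le> n \<Longrightarrow> AE \<omega> in M. real_cond_exp M (F n) (\<xi> n) \<omega> \<le> K / (real n)\<^sup>2"
    and pos: "0 \<le> B" "0 < C" "0 < d"
    and "0 < \<epsilon>"
  shows "\<exists>a>0. \<forall>\<^sub>F n in sequentially. measure M {\<omega> \<in> space M. Y n \<omega> > \<epsilon>} \<le> exp (- a * real n)"
proof -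
  interpret prob_space M by fact
  \<comment> \<open>The largest ratio \<open>\<theta> / k\<close> for which the quadratic noise term stays below a quarter of the drift
      and \<open>\<theta> * (C / k) \<le> 1\<close>; the conditional mean of the noise uses up another quarter.\<close>
  define \<eta> where "\<eta> = min (1 / C) (d / (4 * C\<^sup>2))"
  have \<eta>: "0 < \<eta>" "\<eta> * C \<le> 1" "\<eta> * C\<^sup>2 \<le> d / 4"
  proof -
    have "\<eta> * C \<le> 1 / C * C" "\<eta> * C\<^sup>2 \<le> d / (4 * C\<^sup>2) * C\<^sup>2"
      using pos by (intro mult_right_mono; simp add: \<eta>_def)+
    then show "0 < \<eta>" "\<eta> * C \<le> 1" "\<eta> * C\<^sup>2 \<le> d / 4"
      using pos by (auto simp: \<eta>_def)
  qed
  \<comment> \<open>Between \<open>\<beta> * n\<close> and \<open>n\<close> the harmonic drift \<open>d / 2\<close> accumulates to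
      \<open>(d / 2) * ln (1 / \<beta>) = B\<close>.\<close>
  define \<beta> where "\<beta> = exp (- 2 * B / d)"
  have \<beta>: "0 < \<beta>" "\<beta> \<le> 1"
    using pos by (auto simp: \<beta>_def)
  have Y_meas_M [measurable]: "Y n \<in> borel_measurable M" for n
    using subalg Y_meas by (rule measurable_from_subalg)
  \<comment> \<open>The threshold on \<open>n\<close> makes \<open>m = \<lfloor>\<beta> * n\<rfloor>\<close> at least \<open>1\<close> and at least \<open>4 * K / d\<close>, so that
      \<open>K / k\<^sup>2 \<le> d / (4 * k)\<close> from time \<open>m\<close> on.\<close>
  have tail: "measure M {\<omega> \<in> space M. Y n \<omega> > \<epsilon>}
      \<le> (1 + 3 * real n) * (exp (\<eta> * \<epsilon>) * exp (- (\<eta> * \<epsilon> * \<beta>) * real n))"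
    if large: "max 1 (4 * K / d) + 1 \<le> \<beta> * real n" for n
  proof -
    define m where "m = nat \<lfloor>\<beta> * real n\<rfloor>"
    have nonneg: "0 \<le> \<beta> * real n"
      using \<beta> by simp
    have m: "real m \<le> \<beta> * real n" "\<beta> * real n - 1 \<le> real m"
      using nonneg unfolding m_def by linarith+
    have "1 \<le> m" "4 * K / d \<le> real m"
      using m large by auto
    have "\<beta> * real n \<le> 1 * real n"
      using \<beta> by (intro mult_right_mono) auto
    then have "m \<le> n"
      using m(1) by simp
    define \<theta> where "\<theta> = \<eta> * real m"
    have "0 < \<theta>"
      using \<eta> \<open>1 \<le> m\<close> by (simp add: \<theta>_def)
    define w where "w k = (\<integral>\<omega>. exp (\<theta> * Y k \<omega>) \<partial>M)" for k
    have int: "integrable M (\<lambda>\<omega>. exp (\<theta> * Y k \<omega>))" for k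
      by (rule integrable_const_bound[where B = "exp (\<theta> * B)"])
        (use Y_bound[of k] \<open>0 < \<theta>\<close> in auto)
    have w_le: "w k \<le> exp (\<theta> * B)" for k
    proof -
      have "w k \<le> (\<integral>\<omega>. exp (\<theta> * B) \<partial>M)"
        unfolding w_def
        by (rule integral_mono_AE) (use int Y_bound[of k] \<open>0 < \<theta>\<close> in auto)
      then show ?thesis
        by (simp add: prob_space)
    qed
    have "w n \<le> exp (- (\<theta> * d / 2) * (ln (real n) - ln (real m))) * w m + 3 * real n"
    proof (rule harmonic_contraction_iterate)
      fix k assume "m \<le> k"
      then have k: "1 \<le> k" "0 < real k" "4 * K / d \<le> real k" "\<theta> \<le> \<eta> * real k"
        using \<open>1 \<le> m\<close> \<open>4 * K / d \<le> real m\<close> \<eta> by (auto simp: \<theta>_def)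
      interpret finite_measure_subalgebra M "F k"
        by unfold_locales (rule subalg)
      have "\<theta> * (C / real k) \<le> (\<eta> * real k) * (C / real k)"
        using k pos by (intro mult_right_mono) auto
      also have "\<dots> \<le> 1"
        using k \<eta> by simp
      finally have \<theta>_small: "\<theta> * (C / real k) \<le> 1" .
      have "\<theta> * (C / real k)\<^sup>2 \<le> (\<eta> * real k) * (C / real k)\<^sup>2"
        using k by (intro mult_right_mono) auto
      also have "\<dots> = (\<eta> * C\<^sup>2) / real k"
        using k by (simp add: power2_eq_square)
      also have "\<dots> \<le> (d / 4) / real k"
        using k \<eta> by (intro divide_right_mono) auto
      finally have "\<theta> * (C / real k)\<^sup>2 \<le> (d / 4) / real k" .
      moreover have "K / (real k)\<^sup>2 \<le> (d / 4) / real k"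
        using k pos by (simp add: field_simps power2_eq_square)
      ultimately have "K / (real k)\<^sup>2 + \<theta> * (C / real k)\<^sup>2 \<le> (d / real k) / 2"
        by (simp add: field_simps)
      then have "w (Suc k) \<le> exp (- \<theta> * (d / real k) / 2) * w k + 3 * measure M (space M)"
        unfolding w_def using k \<theta>_small \<open>0 < \<theta>\<close>
        by (intro exp_moment_step[where B = B and c = "C / real k" and \<xi> = "\<xi> k" and k = "K / (real k)\<^sup>2"]
            Y_meas Y_meas_M Y_bound increment drift \<xi>_meas \<xi>_bound \<xi>_mean) auto
      then show "w (Suc k) \<le> exp (- (\<theta> * d / 2) / real k) * w k + 3"
        by (simp add: prob_space mult.commute)
    qed (use \<open>1 \<le> m\<close> \<open>m \<le> n\<close> \<open>0 < \<theta>\<close> pos in \<open>auto simp: w_def\<close>)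
    also have "\<dots> \<le> exp (- \<theta> * B) * exp (\<theta> * B) + 3 * real n"
    proof (intro add_mono mult_mono order_refl w_le)
      have "ln (real m) \<le> ln (\<beta> * real n)"
        using m(1) \<open>1 \<le> m\<close> by simp
      also have "\<dots> = - 2 * B / d + ln (real n)"
        using \<beta> \<open>1 \<le> m\<close> \<open>m \<le> n\<close> by (simp add: ln_mult \<beta>_def)
      finally have "2 * B / d \<le> ln (real n) - ln (real m)"
        by simp
      then have "\<theta> * d / 2 * (2 * B / d) \<le> \<theta> * d / 2 * (ln (real n) - ln (real m))"
        using \<open>0 < \<theta>\<close> pos by (intro mult_left_mono) auto
      then show "exp (- (\<theta> * d / 2) * (ln (real n) - ln (real m))) \<le> exp (- \<theta> * B)"
        using pos by simp
    qed (auto simp: w_def)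
    finally have w_n: "w n \<le> 1 + 3 * real n"
      by (simp flip: exp_add)
    have "measure M {\<omega> \<in> space M. Y n \<omega> > \<epsilon>}
        \<le> measure M {\<omega> \<in> space M. exp (\<theta> * Y n \<omega>) \<ge> exp (\<theta> * \<epsilon>)}"
      using \<open>0 < \<theta>\<close> by (intro finite_measure_mono) auto
    also have "\<dots> \<le> w n / exp (\<theta> * \<epsilon>)"
      unfolding w_def by (rule integral_Markov_inequality_measure[OF int]) (rule sets.empty_sets, auto)
    also have "\<dots> \<le> (1 + 3 * real n) * exp (- \<theta> * \<epsilon>)"
      using w_n by (simp add: exp_minus field_simps)
    also have "\<dots> \<le> (1 + 3 * real n) * exp (\<eta> * \<epsilon> - (\<eta> * \<epsilon> * \<beta>) * real n)"
    proof (intro mult_left_mono)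
      have "\<eta> * \<epsilon> * (\<beta> * real n - 1) \<le> \<eta> * \<epsilon> * real m"
        using m(2) \<eta> \<open>0 < \<epsilon>\<close> by (intro mult_left_mono) auto
      then show "exp (- \<theta> * \<epsilon>) \<le> exp (\<eta> * \<epsilon> - (\<eta> * \<epsilon> * \<beta>) * real n)"
        by (simp add: \<theta>_def algebra_simps)
    qed simp
    finally show ?thesis
      by (simp add: exp_diff exp_minus field_simps)
  qed
  have c: "0 < \<eta> * \<epsilon> * \<beta>"
    using \<eta> \<beta> \<open>0 < \<epsilon>\<close> by simp
  have "filterlim (\<lambda>n. \<beta> * real n) at_top sequentially"
    using \<beta> by real_asymp
  then have "\<forall>\<^sub>F n in sequentially. max 1 (4 * K / d) + 1 \<le> \<beta> * real n"
    by (simp add: filterlim_at_top)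
  with eventually_linear_times_exp_le[OF c, of "exp (\<eta> * \<epsilon>)"]
  have "\<forall>\<^sub>F n in sequentially. measure M {\<omega> \<in> space M. Y n \<omega> > \<epsilon>}
      \<le> exp (- (\<eta> * \<epsilon> * \<beta> / 2) * real n)"
  proof eventually_elim
    case (elim n)
    then show ?case
      using tail[of n] by linarith
  qed
  then show ?thesis
    using c by (intro exI[of _ "\<eta> * \<epsilon> * \<beta> / 2"]) auto
qed

section \<open>Drift towards a stable point\<close>

text \<open>
  The negative derivative gives the strict sign of \<open>g\<close> at some points arbitrarily close to \<open>p\<close> on both
  sides, and monotonicity carries it outwards. Near an endpoint of the unit interval one of the
  two sides may be empty, and the constant for that side is arbitrary.
\<close>
lemma antimono_strict_beyond_stable_point:
  assumes anti: "antimono_on {0..1} g" and stable: "stable_point g p" and "0 < \<eta>"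
  obtains \<delta> where "0 < \<delta>"
    and "\<And>x. x \<in> {0..1} \<Longrightarrow> p + \<eta> < x \<Longrightarrow> g x \<le> - \<delta>"
    and "\<And>x. x \<in> {0..1} \<Longrightarrow> x < p - \<eta> \<Longrightarrow> \<delta> \<le> g x"
proof -
  obtain D where p: "p \<in> {0..1}" "g p = 0" and D: "D < 0"
    "(g has_real_derivative D) (at p within {0..1})"
    using stable by (auto simp: stable_point_def)
  obtain r where r: "0 < r" "\<And>h. 0 < h \<Longrightarrow> p + h \<in> {0..1} \<Longrightarrow> h < r \<Longrightarrow> g (p + h) < 0"
    using has_real_derivative_neg_dec_right[OF D(2,1)] p(2) by auto
  obtain l where l: "0 < l" "\<And>h. 0 < h \<Longrightarrow> p - h \<in> {0..1} \<Longrightarrow> h < l \<Longrightarrow> 0 < g (p - h)"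
    using has_real_derivative_neg_dec_left[OF D(2,1)] p(2) by auto
  define s where "s = min \<eta> (min (r / 2) (l / 2))"
  have s: "0 < s" "s < r" "s < l" "s \<le> \<eta>"
    using r(1) l(1) \<open>0 < \<eta>\<close> by (auto simp: s_def min_less_iff_disj)
  define \<delta>1 where "\<delta>1 = (if p + s \<le> 1 then - g (p + s) else 1)"
  define \<delta>2 where "\<delta>2 = (if 0 \<le> p - s then g (p - s) else 1)"
  have decreasing: "g y \<le> g x" if "x \<in> {0..1}" "y \<in> {0..1}" "x \<le> y" for x y
    using anti that by (auto simp: monotone_on_def)
  show thesis
  proof (rule that[of "min \<delta>1 \<delta>2"])
    show "0 < min \<delta>1 \<delta>2"
      using r(2)[of s] l(2)[of s] s p(1) by (auto simp: \<delta>1_def \<delta>2_def)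
  next
    fix x assume x: "x \<in> {0..1}" "p + \<eta> < x"
    then have "g x \<le> - \<delta>1"
      using decreasing[of "p + s" x] s p(1) by (auto simp: \<delta>1_def)
    then show "g x \<le> - min \<delta>1 \<delta>2"
      by linarith
  next
    fix x assume x: "x \<in> {0..1}" "x < p - \<eta>"
    then have "\<delta>2 \<le> g x"
      using decreasing[of x "p - s"] s p(1) by (auto simp: \<delta>2_def)
    then show "min \<delta>1 \<delta>2 \<le> g x"
      by linarith
  qed
qed

section \<open>Exponential concentration of the algorithm\<close>

theorem theorem2p2:
  fixes M :: "'a measure" and F :: "nat \<Rightarrow> 'a measure"
    and X \<gamma> U :: "nat \<Rightarrow> 'a \<Rightarrow> real"
    and g :: "real \<Rightarrow> real"
    and x0 xstar u_l u_u K_g K_u K_e :: real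
  assumes "prob_space M"
    and "filtration (space M) F"
    and "\<And>n. subalgebra M (F n)"
    and X_adapted: "\<And>n. X n \<in> borel_measurable (F n)"
    and X_range: "\<And>n \<omega>. \<omega> \<in> space M \<Longrightarrow> X n \<omega> \<in> {0..1}"
    and \<gamma>_adapted: "\<And>n. n \<ge> 1 \<Longrightarrow> \<gamma> n \<in> borel_measurable (F n)"
    and U_adapted: "\<And>n. n \<ge> 1 \<Longrightarrow> U n \<in> borel_measurable (F n)"
    and X_0: "AE \<omega> in M. X 0 \<omega> = x0"
    and X_step: "\<And>n. AE \<omega> in M.
      X (n + 1) \<omega> - X n \<omega> = \<gamma> (n + 1) \<omega> * (g (X n \<omega>) + U (n + 1) \<omega>)"
    and "u_l > 0" "u_u > 0" "K_g > 0" "K_u > 0" "K_e > 0"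
    and \<gamma>_bounds: "\<And>n. n \<ge> 1 \<Longrightarrow> AE \<omega> in M. u_l / real n \<le> \<gamma> n \<omega> \<and> \<gamma> n \<omega> \<le> u_u / real n"
    and g_bound: "\<And>x. x \<in> {0..1} \<Longrightarrow> \<bar>g x\<bar> \<le> K_g"
    and U_bound: "\<And>n. AE \<omega> in M. \<bar>U (n + 1) \<omega>\<bar> \<le> K_u"
    and cond_exp_bound: "\<And>n. n \<ge> 1 \<Longrightarrow> AE \<omega> in M.
      \<bar>real_cond_exp M (F n) (\<lambda>\<omega>. \<gamma> (n + 1) \<omega> * U (n + 1) \<omega>) \<omega>\<bar> \<le> K_e / (real n)\<^sup>2"
    and "antimono_on {0..1} g"
    and "continuous_on {0..1} g"
    and "stable_point g xstar"
    and "\<And>y. stable_point g y \<Longrightarrow> y = xstar"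
  shows "\<forall>\<epsilon>>0. \<exists>a>0. \<forall>\<^sub>F n in sequentially.
    measure M {\<omega> \<in> space M. \<bar>X (n + 1) \<omega> - xstar\<bar> > \<epsilon>} \<le> 2 * exp (- a * real n)"
proof (intro allI impI)
  fix \<epsilon> :: real
  assume "\<epsilon> > 0"
  interpret prob_space M by fact
  have meas_M: "f \<in> borel_measurable M" if "f \<in> borel_measurable (F n)" for f :: "'a \<Rightarrow> real" and n
    using assms(3) that by (rule measurable_from_subalg)
  have X_meas [measurable]: "X n \<in> borel_measurable M" for n
    using X_adapted by (rule meas_M)
  define \<xi> where "\<xi> n \<omega> = \<gamma> (n + 1) \<omega> * U (n + 1) \<omega>" for n \<omega>
  have \<xi>_meas [measurable]: "\<xi> n \<in> borel_measurable M" for n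
    using meas_M[OF \<gamma>_adapted[of "n + 1"]] meas_M[OF U_adapted[of "n + 1"]]
    unfolding \<xi>_def by measurable
  define C where "C = u_u * (K_g + K_u)"
  have "0 < C"
    using assms(10-14) by (simp add: C_def)
  have half_eps: "0 < \<epsilon> / 2"
    using \<open>\<epsilon> > 0\<close> by simp
  have p: "xstar \<in> {0..1}"
    using \<open>stable_point g xstar\<close> by (simp add: stable_point_def)
  obtain \<delta> where \<delta>: "0 < \<delta>"
    and g_above: "\<And>x. x \<in> {0..1} \<Longrightarrow> xstar + \<epsilon> / 2 < x \<Longrightarrow> g x \<le> - \<delta>"
    and g_below: "\<And>x. x \<in> {0..1} \<Longrightarrow> x < xstar - \<epsilon> / 2 \<Longrightarrow> \<delta> \<le> g x"
    using antimono_strict_beyond_stable_point[OF \<open>antimono_on {0..1} g\<close> \<open>stable_point g xstar\<close> half_eps]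
    by blast
  \<comment> \<open>The factor one half absorbs the shift in \<open>1 / (n + 1) \<ge> 1 / (2 * n)\<close>.\<close>
  define d where "d = \<delta> * u_l / 2"
  have "0 < d"
    using \<delta> \<open>u_l > 0\<close> by (simp add: d_def)
  have gain: "AE \<omega> in M. 0 \<le> \<gamma> (n + 1) \<omega> \<and> \<gamma> (n + 1) \<omega> \<le> u_u / real n \<and> d / real n \<le> \<gamma> (n + 1) \<omega> * \<delta>"
    if "1 \<le> n" for n
    using \<gamma>_bounds[of "n + 1", OF le_add2]
  proof eventually_elim
    case (elim \<omega>)
    have "u_l / (2 * real n) \<le> u_l / (1 + real n)" "u_u / (1 + real n) \<le> u_u / real n"
      "0 \<le> u_l / (1 + real n)"
      using that \<open>u_l > 0\<close> \<open>u_u > 0\<close> by (auto intro!: divide_left_mono)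
    then have "0 \<le> \<gamma> (n + 1) \<omega>" "\<gamma> (n + 1) \<omega> \<le> u_u / real n" "u_l / (2 * real n) \<le> \<gamma> (n + 1) \<omega>"
      using elim by auto
    moreover have "u_l / (2 * real n) * \<delta> \<le> \<gamma> (n + 1) \<omega> * \<delta>"
      using calculation \<delta> by (intro mult_right_mono) auto
    ultimately show ?case
      by (simp add: d_def mult.commute)
  qed
  have \<xi>_bound: "AE \<omega> in M. \<bar>\<xi> n \<omega>\<bar> \<le> C / real n" if "1 \<le> n" for n
    using gain[OF that] U_bound[of n]
  proof eventually_elim
    case (elim \<omega>)
    then have "\<bar>\<xi> n \<omega>\<bar> \<le> (u_u / real n) * (K_g + K_u)"
      unfolding \<xi>_def abs_mult using \<open>K_g > 0\<close> \<open>u_u > 0\<close> by (intro mult_mono) auto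
    then show ?case
      by (simp add: C_def)
  qed
  have increment: "AE \<omega> in M. \<bar>X (Suc n) \<omega> - X n \<omega>\<bar> \<le> C / real n" if "1 \<le> n" for n
    using gain[OF that] U_bound[of n] X_step[of n] AE_space
  proof eventually_elim
    case (elim \<omega>)
    have "\<bar>g (X n \<omega>) + U (n + 1) \<omega>\<bar> \<le> K_g + K_u"
      using g_bound[OF X_range[OF elim(4), of n]] elim(2) by linarith
    then have "\<bar>\<gamma> (n + 1) \<omega>\<bar> * \<bar>g (X n \<omega>) + U (n + 1) \<omega>\<bar> \<le> (u_u / real n) * (K_g + K_u)"
      using elim(1) \<open>u_u > 0\<close> by (intro mult_mono) auto
    then show ?case
      using elim(3) by (simp add: C_def abs_mult)
  qed
  have \<xi>_mean: "AE \<omega> in M. \<bar>real_cond_exp M (F n) (\<xi> n) \<omega>\<bar> \<le> K_e / (real n)\<^sup>2" if "1 \<le> n" for n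
    using cond_exp_bound[OF that] unfolding \<xi>_def .
  have neg_\<xi>_mean: "AE \<omega> in M. real_cond_exp M (F n) (\<lambda>\<omega>. - \<xi> n \<omega>) \<omega> \<le> K_e / (real n)\<^sup>2"
    if "1 \<le> n" for n
  proof -
    interpret finite_measure_subalgebra M "F n"
      by unfold_locales (rule assms(3))
    have "integrable M (\<xi> n)"
      by (rule integrable_const_bound[where B = "C / real n"]) (use \<xi>_bound[OF that] in auto)
    from real_cond_exp_cmult[OF this, of "-1"] \<xi>_mean[OF that] show ?thesis
      by eventually_elim (auto simp: abs_le_iff)
  qed
  have "\<exists>a>0. \<forall>\<^sub>F n in sequentially.
      measure M {\<omega> \<in> space M. X n \<omega> - (xstar + \<epsilon> / 2) > \<epsilon> / 2} \<le> exp (- a * real n)"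
  proof (rule exponential_tail_of_harmonic_drift[where \<xi> = \<xi> and F = F and B = 1 and C = C and d = d and K = K_e])
    show "AE \<omega> in M. X n \<omega> - (xstar + \<epsilon> / 2) \<le> 1" for n
      using AE_space by eventually_elim (use X_range[of _ n] p half_eps in fastforce)
    show "AE \<omega> in M. 0 < X n \<omega> - (xstar + \<epsilon> / 2) \<longrightarrow>
        X (Suc n) \<omega> - (xstar + \<epsilon> / 2) \<le> X n \<omega> - (xstar + \<epsilon> / 2) - d / real n + \<xi> n \<omega>"
      if "1 \<le> n" for n
      using gain[OF that] X_step[of n] AE_space
    proof eventually_elim
      case (elim \<omega>)
      show ?case
      proof
        assume "0 < X n \<omega> - (xstar + \<epsilon> / 2)"
        then have "\<gamma> (n + 1) \<omega> * g (X n \<omega>) \<le> \<gamma> (n + 1) \<omega> * - \<delta>"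
          using elim X_range[OF elim(3), of n] by (intro mult_left_mono g_above) auto
        then show "X (Suc n) \<omega> - (xstar + \<epsilon> / 2)
            \<le> X n \<omega> - (xstar + \<epsilon> / 2) - d / real n + \<xi> n \<omega>"
          using elim by (simp add: \<xi>_def algebra_simps)
      qed
    qed
    show "AE \<omega> in M. real_cond_exp M (F n) (\<xi> n) \<omega> \<le> K_e / (real n)\<^sup>2" if "1 \<le> n" for n
      using \<xi>_mean[OF that] by eventually_elim simp
    show "(\<lambda>\<omega>. X n \<omega> - (xstar + \<epsilon> / 2)) \<in> borel_measurable (F n)" for n
      using X_adapted[of n] by measurable
  qed (use \<open>prob_space M\<close> assms(3) \<xi>_bound increment half_eps \<open>0 < C\<close> \<open>0 < d\<close> in auto)
  then obtain a1 where a1: "a1 > 0" and above: "\<forall>\<^sub>F n in sequentially.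
      measure M {\<omega> \<in> space M. X n \<omega> - (xstar + \<epsilon> / 2) > \<epsilon> / 2} \<le> exp (- a1 * real n)"
    by blast
  have "\<exists>a>0. \<forall>\<^sub>F n in sequentially.
      measure M {\<omega> \<in> space M. xstar - \<epsilon> / 2 - X n \<omega> > \<epsilon> / 2} \<le> exp (- a * real n)"
  proof (rule exponential_tail_of_harmonic_drift[where \<xi> = "\<lambda>n \<omega>. - \<xi> n \<omega>" and F = F and B = 1 and C = C and d = d and K = K_e])
    show "AE \<omega> in M. xstar - \<epsilon> / 2 - X n \<omega> \<le> 1" for n
      using AE_space by eventually_elim (use X_range[of _ n] p half_eps in fastforce)
    show "AE \<omega> in M. 0 < xstar - \<epsilon> / 2 - X n \<omega> \<longrightarrow>
        xstar - \<epsilon> / 2 - X (Suc n) \<omega> \<le> xstar - \<epsilon> / 2 - X n \<omega> - d / real n + - \<xi> n \<omega>"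
      if "1 \<le> n" for n
      using gain[OF that] X_step[of n] AE_space
    proof eventually_elim
      case (elim \<omega>)
      show ?case
      proof
        assume "0 < xstar - \<epsilon> / 2 - X n \<omega>"
        then have "\<gamma> (n + 1) \<omega> * \<delta> \<le> \<gamma> (n + 1) \<omega> * g (X n \<omega>)"
          using elim X_range[OF elim(3), of n] by (intro mult_left_mono g_below) auto
        then show "xstar - \<epsilon> / 2 - X (Suc n) \<omega>
            \<le> xstar - \<epsilon> / 2 - X n \<omega> - d / real n + - \<xi> n \<omega>"
          using elim by (simp add: \<xi>_def algebra_simps)
      qed
    qed
    show "AE \<omega> in M. \<bar>xstar - \<epsilon> / 2 - X (Suc n) \<omega> - (xstar - \<epsilon> / 2 - X n \<omega>)\<bar> \<le> C / real n"
      if "1 \<le> n" for n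
      using increment[OF that] by eventually_elim auto
    show "(\<lambda>\<omega>. xstar - \<epsilon> / 2 - X n \<omega>) \<in> borel_measurable (F n)" for n
      using X_adapted[of n] by measurable
  qed (use \<open>prob_space M\<close> assms(3) \<xi>_bound neg_\<xi>_mean half_eps \<open>0 < C\<close> \<open>0 < d\<close> in auto)
  then obtain a2 where a2: "a2 > 0" and below: "\<forall>\<^sub>F n in sequentially.
      measure M {\<omega> \<in> space M. xstar - \<epsilon> / 2 - X n \<omega> > \<epsilon> / 2} \<le> exp (- a2 * real n)"
    by blast
  \<comment> \<open>The rates are stated at time \<open>n + 1\<close>, so passing to \<open>n\<close> loses nothing.\<close>
  define a where "a = min a1 a2"
  have exp_a: "exp (- b * real (Suc n)) \<le> exp (- a * real n)" if "a \<le> b" for b n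
  proof -
    have "a * real n \<le> b * real (Suc n)"
      using that a1 a2 by (intro mult_mono) (auto simp: a_def)
    then show ?thesis
      by simp
  qed
  have "\<forall>\<^sub>F n in sequentially.
      measure M {\<omega> \<in> space M. \<bar>X (n + 1) \<omega> - xstar\<bar> > \<epsilon>} \<le> 2 * exp (- a * real n)"
    using above[THEN eventually_sequentially_Suc[THEN iffD2]]
      below[THEN eventually_sequentially_Suc[THEN iffD2]]
  proof eventually_elim
    case (elim n)
    have "measure M {\<omega> \<in> space M. \<bar>X (n + 1) \<omega> - xstar\<bar> > \<epsilon>}
        \<le> measure M ({\<omega> \<in> space M. X (Suc n) \<omega> - (xstar + \<epsilon> / 2) > \<epsilon> / 2}
          \<union> {\<omega> \<in> space M. xstar - \<epsilon> / 2 - X (Suc n) \<omega> > \<epsilon> / 2})"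
    proof (rule finite_measure_mono)
      show "{\<omega> \<in> space M. \<bar>X (n + 1) \<omega> - xstar\<bar> > \<epsilon>}
          \<subseteq> {\<omega> \<in> space M. X (Suc n) \<omega> - (xstar + \<epsilon> / 2) > \<epsilon> / 2}
            \<union> {\<omega> \<in> space M. xstar - \<epsilon> / 2 - X (Suc n) \<omega> > \<epsilon> / 2}"
        unfolding Suc_eq_plus1
      proof (intro subsetI, elim CollectE conjE)
        fix \<omega>
        assume "\<omega> \<in> space M" and far: "\<bar>X (n + 1) \<omega> - xstar\<bar> > \<epsilon>"
        from far have "X (n + 1) \<omega> - (xstar + \<epsilon> / 2) > \<epsilon> / 2 \<or> xstar - \<epsilon> / 2 - X (n + 1) \<omega> > \<epsilon> / 2"
          by linarith
        with \<open>\<omega> \<in> space M\<close> show "\<omega> \<in> {\<omega> \<in> space M. X (n + 1) \<omega> - (xstar + \<epsilon> / 2) > \<epsilon> / 2}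
            \<union> {\<omega> \<in> space M. xstar - \<epsilon> / 2 - X (n + 1) \<omega> > \<epsilon> / 2}"
          by blast
      qed
    qed simp
    also have "\<dots> \<le> measure M {\<omega> \<in> space M. X (Suc n) \<omega> - (xstar + \<epsilon> / 2) > \<epsilon> / 2}
        + measure M {\<omega> \<in> space M. xstar - \<epsilon> / 2 - X (Suc n) \<omega> > \<epsilon> / 2}"
      by (rule measure_Un_le) auto
    also have "\<dots> \<le> 2 * exp (- a * real n)"
    proof -
      have "exp (- a1 * real (Suc n)) \<le> exp (- a * real n)" "exp (- a2 * real (Suc n)) \<le> exp (- a * real n)"
        by (intro exp_a; simp add: a_def)+
      then show ?thesis
        using elim by linarith
    qed
    finally show ?case .
  qed
  then show "\<exists>a>0. \<forall>\<^sub>F n in sequentially.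
      measure M {\<omega> \<in> space M. \<bar>X (n + 1) \<omega> - xstar\<bar> > \<epsilon>} \<le> 2 * exp (- a * real n)"
    using a1 a2 by (intro exI[of _ a]) (auto simp: a_def)
qed

end
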